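(* Let $p\in L$ be a proper element and let $b\in L$ be $\phi$-$\delta$-primary to $p$. If $pb\not\leqslant\phi(p)$ then $b$ is $\delta$-primary to $p$.
   Context: A multiplicative lattice is a complete lattice (least element $0$, largest element $1$) with a commutative, associative multiplication that distributes over arbitrary joins and has $1$ as multiplicative identity. An element $a$ is compact if whenever $a\leqslant \vee X$ for $X\subseteq L$ there are finitely many $a_1,\dots,a_n\in X$ with $a\leqslant a_1\vee\cdots\vee a_n$. Standing assumptions: $L$ is a compactly generated multiplicative lattice (every element is a join of compact elements), $1$ is compact, and every finite product of compact elements is compact. An element $p$ is proper if $p<1$. $\delta:L\to L$ is an expansion function: $a\leqslant\delta(a)$ for all $a$, and $a\leqslant b$ implies $\delta(a)\leqslant\delta(b)$. $\phi:L\to L$ is a function, assumed to satisfy $\phi(q)\leqslant q$ for all $q\in L$. An element $b$ is $\delta$-primary to a proper element $p$ if for all $x\in L$, $xb\leqslant p$ implies $x\leqslant\delta(p)$; it is $\phi$-$\delta$-primary to $p$ if for all $x\in L$, $xb\leqslant p$ and $xb\not\leqslant\phi(p)$ implies $x\leqslant\delta(p)$. *)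

theory Defs
  imports Main
begin

text \<open>The least and largest elements are \<^term>\<open>bot\<close> and \<^term>\<open>top\<close>; the latter coincides with
  the multiplicative identity \<^term>\<open>1\<close>.\<close>

class multiplicative_lattice = complete_lattice + comm_monoid_mult +
  assumes one_eq_top: "1 = top"
    and mult_Sup_distrib: "a * Sup X = Sup ((\<lambda>x. a * x) ` X)"
begin

text \<open>The finite set \<open>F\<close> may be empty, which is only needed for \<open>X = {}\<close>, \<open>a = bot\<close>.\<close>

definition compact_element :: "'a \<Rightarrow> bool" where
  "compact_element a \<longleftrightarrow>
     (\<forall>X. a \<le> Sup X \<longrightarrow> (\<exists>F. F \<subseteq> X \<and> finite F \<and> a \<le> Sup F))"

definition proper :: "'a \<Rightarrow> bool" where
  "proper p \<longleftrightarrow> p < 1"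

definition expansion_function :: "('a \<Rightarrow> 'a) \<Rightarrow> bool" where
  "expansion_function \<delta> \<longleftrightarrow> (\<forall>a. a \<le> \<delta> a) \<and> (\<forall>a b. a \<le> b \<longrightarrow> \<delta> a \<le> \<delta> b)"

definition delta_primary_to :: "('a \<Rightarrow> 'a) \<Rightarrow> 'a \<Rightarrow> 'a \<Rightarrow> bool" where
  "delta_primary_to \<delta> b p \<longleftrightarrow> (\<forall>x. x * b \<le> p \<longrightarrow> x \<le> \<delta> p)"

definition phi_delta_primary_to :: "('a \<Rightarrow> 'a) \<Rightarrow> ('a \<Rightarrow> 'a) \<Rightarrow> 'a \<Rightarrow> 'a \<Rightarrow> bool" where
  "phi_delta_primary_to \<phi> \<delta> b p \<longleftrightarrow>
     (\<forall>x. x * b \<le> p \<and> \<not> x * b \<le> \<phi> p \<longrightarrow> x \<le> \<delta> p)"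

end

class compactly_generated_multiplicative_lattice = multiplicative_lattice +
  assumes compactly_generated: "\<exists>C. (\<forall>c\<in>C. compact_element c) \<and> a = Sup C"
    and compact_one: "compact_element 1"
    and compact_prod_list: "(\<forall>c\<in>set cs. compact_element c) \<Longrightarrow> compact_element (prod_list cs)"

end

theory Submission imports Defs begin

text \<open>Enlarge a given x with xb \<le> p to x \<or> p. By \<open>mult_sup_distrib\<close> and
  \<open>mult_le_left\<close>, (x \<or> p)b = xb \<or> pb is still below p, while the summand pb
  keeps it from lying below \<phi>(p). So the weaker hypothesis applies to x \<or> p, which bounds
  x.\<close>

lemma mult_sup_distrib:
  fixes a x y :: "'a::multiplicative_lattice"
  shows "a * sup x y = sup (a * x) (a * y)"
  using mult_Sup_distrib[of a "{x, y}"] by simp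

text \<open>As 1 is the top element, ab \<or> a = a(b \<or> 1) = a.\<close>

lemma mult_le_left:
  fixes a b :: "'a::multiplicative_lattice"
  shows "a * b \<le> a"
proof -
  have "sup (a * b) a = a * sup b 1"
    by (simp add: mult_sup_distrib)
  also have "\<dots> = a"
    \<comment> \<open>\<open>1\<close> becomes \<open>top\<close> to absorb \<open>b\<close>, then
      \<open>top\<close> is turned back into \<open>1\<close> so that the unit law applies.\<close>
    by (simp only: one_eq_top sup_top_right) (simp flip: one_eq_top)
  finally show ?thesis
    by (simp add: le_iff_sup)
qed

theorem theorem2p27:
  fixes \<delta> \<phi> :: "'a::compactly_generated_multiplicative_lattice \<Rightarrow> 'a"
    and p b :: 'a
  assumes "expansion_function \<delta>"
    and "\<And>q. \<phi> q \<le> q"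
    and "proper p"
    and "phi_delta_primary_to \<phi> \<delta> b p"
    and "\<not> p * b \<le> \<phi> p"
  shows "delta_primary_to \<delta> b p"
  unfolding delta_primary_to_def
proof (intro allI impI)
  fix x
  assume "x * b \<le> p"
  have eq: "sup x p * b = sup (x * b) (p * b)"
    by (simp add: mult_sup_distrib mult.commute[of _ b])
  have "sup x p * b \<le> p"
    using \<open>x * b \<le> p\<close> mult_le_left[of p b] by (simp add: eq)
  \<comment> \<open>A join is below \<open>\<phi> p\<close> only if both its parts are.\<close>
  moreover have "\<not> sup x p * b \<le> \<phi> p"
    using assms(5) by (simp add: eq)
  ultimately have "sup x p \<le> \<delta> p"
    using assms(4) by (auto simp only: phi_delta_primary_to_def)
  then show "x \<le> \<delta> p"
    by simp
qed

end
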